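(* Let $\mathbf{C}$ be the natural deduction system described in the context. Any deduction in $\mathbf{C}$ can be converted into a deduction in $\mathbf{C}$ in normal form (with the same conclusion).
   Context: Formulas are built from atomic formulas (formulas containing no connective) by the connectives $\neg$ (unary), $\supset$, $\land$, $\lor$. Deductions in $\mathbf{C}$ are trees of formula occurrences whose leaves are assumptions; each assumption belongs to an assumption class marked by a number, and a rule discharging class $i$ (written $[X]^i$) discharges all assumptions of that class above the indicated premise. A single assumption $A$ is a deduction of $A$ from $A$. Rules ($C$ arbitrary): $\land I$: from $A$, $B$, and a deduction of $C$ from $[A\land B]$, infer $C$. $\land E$: from $A\land B$ and a deduction of $C$ from $[A]$, $[B]$, infer $C$. $\lor I$: from $A$ (or from $B$) and a deduction of $C$ from $[A\lor B]$, infer $C$. $\lor E$: from $A\lor B$, a deduction of $C$ from $[A]$, and a deduction of $C$ from $[B]$, infer $C$. $\supset I$: from $B$ and a deduction of $C$ from $[A\supset B]$, infer $C$. $TR$ (an introduction rule for $\supset$): from a deduction of $C$ from $[A]$ and a deduction of $C$ from $[A\supset B]$, infer $C$. $\supset E$: from $A\supset B$, $A$, and a deduction of $C$ from $[B]$, infer $C$. $\neg I$: from a deduction of $C$ from $[A]$ and a deduction of $C$ from $[\neg A]$, infer $C$. $\neg E$: from $\neg A$ and $A$, infer $C$. Introduction rules: $\land I,\lor I,\supset I,TR,\neg I$; elimination rules: $\land E,\lor E,\supset E,\neg E$. In elimination rules $A\land B, A\lor B, A\supset B,\neg A$ are the major premises; premises in the place of $C$ (in any rule) are arbitrary premises; the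 discharged $A\land B$, $A\lor B$, $A\supset B$ (in $\supset I$ and $TR$), $\neg A$ (in $\neg I$) are the major assumptions discharged by the introduction rule. Convention: there is no vacuous discharge above arbitrary premises. A maximal formula is an occurrence of a formula with main connective $\ast$ that is both the major premise of an application of $\ast E$ and the major assumption discharged by an application of $\ast I$ (or of $TR$ when $\ast$ is $\supset$). A segment is a sequence $C_1,\dots,C_n$ of occurrences of the same formula such that for all $i<n$, $C_i$ is an arbitrary premise of a rule application whose conclusion is $C_{i+1}$, $C_n$ is not an arbitrary premise of any rule application, and either $n>1$, or $n\ge 1$ and $C_1$ is the conclusion of an application of $\neg E$. A maximal segment is a segment whose last formula is the major premise of an elimination rule. A deduction is in normal form if it contains neither maximal formulas nor maximal segments. *)

theory Defs
  imports Main
begin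

datatype 'a form =
    Atom 'a
  | Neg "'a form"
  | Imp "'a form" "'a form"
  | Conj "'a form" "'a form"
  | Disj "'a form" "'a form"

text \<open>An assumption class is a number together with the formula it marks.\<close>

type_synonym 'a aclass = "nat \<times> 'a form"

text \<open>
  The names of rule applications carry the schematic formulas of the rule and the numbers of the
  discharged classes, in the order in which the discharged formulas appear in the rule; the
  conclusion \<open>C\<close>, arbitrary in every rule, is stored in the deduction tree.
\<close>

datatype 'a rule =
    ConjI "'a form" "'a form" nat
  | ConjE "'a form" "'a form" nat nat
  | DisjI1 "'a form" "'a form" nat
  | DisjI2 "'a form" "'a form" nat
  | DisjE "'a form" "'a form" nat nat
  | ImpI "'a form" "'a form" nat
  | TR "'a form" "'a form" nat nat
  | ImpE "'a form" "'a form" nat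
  | NegI "'a form" nat nat
  | NegE "'a form"

datatype role = Major | Minor | Arbitrary

datatype 'a premise =
  Premise (role: role) (formula: "'a form") (discharged: "'a aclass set")

fun rule_premises :: "'a rule \<Rightarrow> 'a form \<Rightarrow> 'a premise list" where
  "rule_premises (ConjI A B i) C =
     [Premise Minor A {}, Premise Minor B {}, Premise Arbitrary C {(i, Conj A B)}]"
| "rule_premises (ConjE A B i j) C =
     [Premise Major (Conj A B) {}, Premise Arbitrary C {(i, A), (j, B)}]"
| "rule_premises (DisjI1 A B i) C =
     [Premise Minor A {}, Premise Arbitrary C {(i, Disj A B)}]"
| "rule_premises (DisjI2 A B i) C =
     [Premise Minor B {}, Premise Arbitrary C {(i, Disj A B)}]"
| "rule_premises (DisjE A B i j) C =
     [Premise Major (Disj A B) {}, Premise Arbitrary C {(i, A)}, Premise Arbitrary C {(j, B)}]"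
| "rule_premises (ImpI A B i) C =
     [Premise Minor B {}, Premise Arbitrary C {(i, Imp A B)}]"
| "rule_premises (TR A B i j) C =
     [Premise Arbitrary C {(i, A)}, Premise Arbitrary C {(j, Imp A B)}]"
| "rule_premises (ImpE A B i) C =
     [Premise Major (Imp A B) {}, Premise Minor A {}, Premise Arbitrary C {(i, B)}]"
| "rule_premises (NegI A i j) C =
     [Premise Arbitrary C {(i, A)}, Premise Arbitrary C {(j, Neg A)}]"
| "rule_premises (NegE A) C =
     [Premise Major (Neg A) {}, Premise Minor A {}]"

fun major_assumption :: "'a rule \<Rightarrow> 'a form option" where
  "major_assumption (ConjI A B i) = Some (Conj A B)"
| "major_assumption (DisjI1 A B i) = Some (Disj A B)"
| "major_assumption (DisjI2 A B i) = Some (Disj A B)"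
| "major_assumption (ImpI A B i) = Some (Imp A B)"
| "major_assumption (TR A B i j) = Some (Imp A B)"
| "major_assumption (NegI A i j) = Some (Neg A)"
| "major_assumption _ = None"

datatype 'a tree =
    Assm nat "'a form"
  | Infer "'a rule" "'a form" "'a tree list"

primrec concl :: "'a tree \<Rightarrow> 'a form" where
  "concl (Assm i A) = A"
| "concl (Infer r C Ds) = C"

text \<open>The classes of undischarged assumptions.\<close>

primrec open_assms :: "'a tree \<Rightarrow> 'a aclass set" where
  "open_assms (Assm i A) = {(i, A)}"
| "open_assms (Infer r C Ds) =
     \<Union> (set (map2 (\<lambda>X P. X - discharged P) (map open_assms Ds) (rule_premises r C)))"

text \<open>
  The last condition is the ban on vacuous discharge above arbitrary premises. It is imposed
  premise by premise: above the arbitrary premise of \<open>ConjE A B i j\<close> at least one assumption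
  \<open>A\<close> or \<open>B\<close> is discharged, not necessarily both.
\<close>

inductive deduction :: "'a tree \<Rightarrow> bool" where
  "deduction (Assm i A)"
| "list_all2
     (\<lambda>D P. deduction D \<and> concl D = formula P \<and>
        (role P = Arbitrary \<longrightarrow> open_assms D \<inter> discharged P \<noteq> {}))
     Ds (rule_premises r C)
   \<Longrightarrow> deduction (Infer r C Ds)"

definition open_formulas :: "'a tree \<Rightarrow> 'a form set" where
  "open_formulas D = snd ` open_assms D"

text \<open>
  Formula occurrences are the nodes of the tree, addressed by their path from the root; the
  formula at a node is the conclusion of the subtree ending there.
\<close>

type_synonym pos = "nat list"

fun subtree :: "'a tree \<Rightarrow> pos \<Rightarrow> 'a tree option" where
  "subtree D [] = Some D"
| "subtree (Assm i A) (k # p) = None"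
| "subtree (Infer r C Ds) (k # p) = (if k < length Ds then subtree (Ds ! k) p else None)"

definition positions :: "'a tree \<Rightarrow> pos set" where
  "positions D = {p. subtree D p \<noteq> None}"

definition formula_at :: "'a tree \<Rightarrow> pos \<Rightarrow> 'a form" where
  "formula_at D p = concl (the (subtree D p))"

definition is_premise :: "role \<Rightarrow> 'a tree \<Rightarrow> pos \<Rightarrow> pos \<Rightarrow> bool" where
  "is_premise \<rho> D p q \<longleftrightarrow>
     (\<exists>k r C Ds. p = q @ [k] \<and> p \<in> positions D \<and> subtree D q = Some (Infer r C Ds) \<and>
        role (rule_premises r C ! k) = \<rho>)"

text \<open>
  An assumption with leaf \<open>p\<close> is discharged by the application nearest to it among those
  below it that discharge its class.
\<close>

definition may_discharge :: "'a tree \<Rightarrow> pos \<Rightarrow> pos \<Rightarrow> bool" where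
  "may_discharge D q p \<longleftrightarrow>
     (\<exists>i A k s r C Ds. subtree D p = Some (Assm i A) \<and> p = q @ k # s \<and>
        subtree D q = Some (Infer r C Ds) \<and> (i, A) \<in> discharged (rule_premises r C ! k))"

definition discharges :: "'a tree \<Rightarrow> pos \<Rightarrow> pos \<Rightarrow> bool" where
  "discharges D q p \<longleftrightarrow>
     may_discharge D q p \<and> (\<forall>q'. may_discharge D q' p \<longrightarrow> length q' \<le> length q)"

definition is_major_premise :: "'a tree \<Rightarrow> pos \<Rightarrow> bool" where
  "is_major_premise D p \<longleftrightarrow> (\<exists>q. is_premise Major D p q)"

definition is_major_assumption :: "'a tree \<Rightarrow> pos \<Rightarrow> bool" where
  "is_major_assumption D p \<longleftrightarrow>
     (\<exists>q r C Ds. discharges D q p \<and> subtree D q = Some (Infer r C Ds) \<and>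
        major_assumption r = Some (formula_at D p))"

text \<open>
  The formula at \<open>p\<close> is both the one eliminated and the one introduced, so the elimination and the
  introduction rule are necessarily for its main connective.
\<close>

definition maximal_formula :: "'a tree \<Rightarrow> pos \<Rightarrow> bool" where
  "maximal_formula D p \<longleftrightarrow> is_major_premise D p \<and> is_major_assumption D p"

definition segment :: "'a tree \<Rightarrow> pos list \<Rightarrow> bool" where
  "segment D ps \<longleftrightarrow>
     ps \<noteq> [] \<and> set ps \<subseteq> positions D \<and>
     (\<forall>p\<in>set ps. \<forall>q\<in>set ps. formula_at D p = formula_at D q) \<and>
     (\<forall>n. Suc n < length ps \<longrightarrow> is_premise Arbitrary D (ps ! n) (ps ! Suc n)) \<and>
     \<not> (\<exists>q. is_premise Arbitrary D (last ps) q) \<and>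
     (1 < length ps \<or> (\<exists>A C Ds. subtree D (hd ps) = Some (Infer (NegE A) C Ds)))"

definition maximal_segment :: "'a tree \<Rightarrow> pos list \<Rightarrow> bool" where
  "maximal_segment D ps \<longleftrightarrow> segment D ps \<and> is_major_premise D (last ps)"

definition normal :: "'a tree \<Rightarrow> bool" where
  "normal D \<longleftrightarrow> (\<nexists>p. maximal_formula D p) \<and> (\<nexists>ps. maximal_segment D ps)"

end

theory Submission
  imports Defs
begin

text \<open>
  The calculus is sound for truth tables, so it suffices to find a normal deduction of every
  consequence of a finite set of formulas. Mark an assumption \<open>0\<close> if it may be eliminated and \<open>1\<close>
  if it is discharged as a major assumption of an introduction rule; a deduction whose major
  premises are all assumptions marked \<open>0\<close> is normal. Suppose no such deduction of \<open>C\<close> exists from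
  \<open>H\<close>, and extend \<open>H\<close> to a maximal set of marked subformulas with this property. Make an atom true
  iff it belongs to this set with mark \<open>0\<close>. By maximality all formulas marked \<open>0\<close> are true, and
  every true subformula belongs to the set with some mark. Hence the assumptions are true
  whereas \<open>C\<close> is false.
\<close>

section \<open>Soundness for truth tables\<close>

fun eval :: "('a \<Rightarrow> bool) \<Rightarrow> 'a form \<Rightarrow> bool" where
  "eval v (Atom a) = v a"
| "eval v (Neg A) = (\<not> eval v A)"
| "eval v (Imp A B) = (eval v A \<longrightarrow> eval v B)"
| "eval v (Conj A B) = (eval v A \<and> eval v B)"
| "eval v (Disj A B) = (eval v A \<or> eval v B)"

lemma open_assms_Infer:
  assumes "length Ds = length (rule_premises r C)"
  shows "open_assms (Infer r C Ds) =
    (\<Union>k<length Ds. open_assms (Ds ! k) - discharged (rule_premises r C ! k))"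
  using assms by (auto simp: set_zip)

text \<open>\<open>TR\<close> and \<open>NegI\<close> use excluded middle: one of their two
  discharged formulas is true, and the premise above which it is discharged yields \<open>C\<close>.
  The premises of \<open>NegE\<close> cannot both be true.\<close>

lemma rule_sound:
  assumes "\<forall>P\<in>set (rule_premises r C).
    (\<forall>x\<in>discharged P. eval v (snd x)) \<longrightarrow> eval v (formula P)"
  shows "eval v C"
  using assms by (cases r) auto

lemma deduction_sound:
  assumes "deduction D" "\<forall>x\<in>open_assms D. eval v (snd x)"
  shows "eval v (concl D)"
  using assms
proof (induction rule: deduction.induct)
  case (1 i A)
  then show ?case by simp
next
  case (2 Ds r C)
  note len = list_all2_lengthD[OF 2(1)]
  have "eval v C"
  proof (rule rule_sound, intro ballI impI)
    fix P
    assume P: "P \<in> set (rule_premises r C)" "\<forall>x\<in>discharged P. eval v (snd x)"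
    then obtain k where k: "k < length Ds" "P = rule_premises r C ! k"
      using len by (metis in_set_conv_nth)
    have "\<forall>x\<in>open_assms (Ds ! k). eval v (snd x)"
      using 2(2) P(2) k unfolding open_assms_Infer[OF len] by blast
    then show "eval v (formula P)"
      using list_all2_nthD[OF 2(1) k(1)] k(2) by auto
  qed
  then show ?case by simp
qed

lemma finite_open_assms: "finite (open_assms D)"
proof (induction D)
  case (Assm i A)
  then show ?case by simp
next
  case (Infer r C Ds)
  then show ?case by (auto elim!: in_set_zipE)
qed

section \<open>Marked deductions and their normality\<close>

text \<open>Formulas are compared without their marks, as in \<open>is_major_assumption\<close>.
  Hence \<open>TR\<close> and \<open>NegI\<close> must not discharge, under mark \<open>0\<close>, a
  formula equal to their major assumption.\<close>

definition separates_marks :: "'a rule \<Rightarrow> bool" where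
  "separates_marks r \<longleftrightarrow>
     (\<forall>C. \<forall>P\<in>set (rule_premises r C). \<forall>A. (0, A) \<in> discharged P \<longrightarrow> major_assumption r \<noteq> Some A)"

inductive marked_deduction :: "'a tree \<Rightarrow> bool" where
  "marked_deduction (Assm i A)"
| "list_all2
     (\<lambda>D P. marked_deduction D \<and> concl D = formula P \<and>
        (role P = Arbitrary \<longrightarrow> open_assms D \<inter> discharged P \<noteq> {}) \<and>
        (role P = Major \<longrightarrow> (\<exists>A. D = Assm 0 A)))
     Ds (rule_premises r C)
   \<Longrightarrow> separates_marks r \<Longrightarrow> marked_deduction (Infer r C Ds)"

lemma marked_deduction_imp_deduction: "marked_deduction D \<Longrightarrow> deduction D"
proof (induction rule: marked_deduction.induct)
  case (2 Ds r C)
  then show ?case by (intro deduction.intros) (auto elim!: list_all2_mono)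
qed (rule deduction.intros)

lemma marked_deduction_subtree:
  "marked_deduction D \<Longrightarrow> subtree D p = Some E \<Longrightarrow> marked_deduction E"
proof (induction D p rule: subtree.induct)
  case (3 r C Ds k p)
  then have "k < length Ds" "subtree (Ds ! k) p = Some E"
    by (auto split: if_splits)
  moreover have "marked_deduction (Ds ! k)"
    using 3(2) \<open>k < length Ds\<close>
    by (cases rule: marked_deduction.cases) (auto dest: list_all2_nthD)
  ultimately show ?case using 3(1) by blast
qed auto

lemma subtree_append:
  "subtree D (p @ q) = Option.bind (subtree D p) (\<lambda>E. subtree E q)"
  by (induction D p rule: subtree.induct) auto

lemma marked_deduction_major_premise:
  assumes "marked_deduction D" "is_major_premise D p"
  obtains A where "subtree D p = Some (Assm 0 A)"
proof -
  obtain q k r C Ds where q: "p = q @ [k]" "p \<in> positions D"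
      "subtree D q = Some (Infer r C Ds)" "role (rule_premises r C ! k) = Major"
    using assms(2) unfolding is_major_premise_def is_premise_def by blast
  have k: "k < length Ds" and p: "subtree D p = Some (Ds ! k)"
    using q(1-3) by (auto simp: positions_def subtree_append split: if_splits)
  have "marked_deduction (Infer r C Ds)"
    using marked_deduction_subtree[OF assms(1) q(3)] .
  then obtain A where "Ds ! k = Assm 0 A"
    using k q(4) by (cases rule: marked_deduction.cases) (auto dest: list_all2_nthD)
  then show thesis using that p by simp
qed

text \<open>A major premise is a leaf marked \<open>0\<close>. Only a rule violating
  \<open>separates_marks\<close> could discharge it as major assumption, and no segment ends in it,
  since the last formula of a segment is the conclusion of a rule.\<close>

lemma marked_deduction_normal:
  assumes D: "marked_deduction D"
  shows "normal D"
proof -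
  have "\<not> maximal_formula D p" for p
  proof
    assume "maximal_formula D p"
    then have maj: "is_major_premise D p" and ass: "is_major_assumption D p"
      unfolding maximal_formula_def by auto
    obtain A where p: "subtree D p = Some (Assm 0 A)"
      using marked_deduction_major_premise[OF D maj] .
    obtain q r C Ds k s where q: "subtree D q = Some (Infer r C Ds)"
        "major_assumption r = Some A" "p = q @ k # s"
        "(0, A) \<in> discharged (rule_premises r C ! k)"
      using ass p unfolding is_major_assumption_def discharges_def may_discharge_def formula_at_def
      by auto
    have "marked_deduction (Infer r C Ds)"
      using marked_deduction_subtree[OF D q(1)] .
    then have "separates_marks r" "length Ds = length (rule_premises r C)"
      by (auto elim: marked_deduction.cases dest: list_all2_lengthD)
    moreover have "k < length Ds"
      using p q(1,3) by (auto simp: subtree_append split: if_splits)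
    ultimately show False
      using q(2,4) unfolding separates_marks_def by (metis nth_mem)
  qed
  moreover have "\<not> maximal_segment D ps" for ps
  proof
    assume "maximal_segment D ps"
    then have seg: "segment D ps" and maj: "is_major_premise D (last ps)"
      unfolding maximal_segment_def by auto
    obtain A where last: "subtree D (last ps) = Some (Assm 0 A)"
      using marked_deduction_major_premise[OF D maj] .
    show False
    proof (cases "1 < length ps")
      case True
      \<comment> \<open>The predecessor of the last occurrence is a premise of a rule concluding
        that occurrence, so the latter is no leaf.\<close>
      then have "Suc (length ps - 2) < length ps" "ps ! Suc (length ps - 2) = last ps"
        by (auto simp: last_conv_nth[of ps] Suc_diff_Suc numeral_2_eq_2 simp flip: length_greater_0_conv)
      then have "is_premise Arbitrary D (ps ! (length ps - 2)) (last ps)"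
        using seg unfolding segment_def by metis
      then show False using last unfolding is_premise_def by auto
    next
      case False
      then have "hd ps = last ps"
        using seg unfolding segment_def by (cases ps) auto
      then show False using False seg last unfolding segment_def by auto
    qed
  qed
  ultimately show ?thesis unfolding normal_def by blast
qed

section \<open>Closure of derivability under the rules\<close>

definition derives :: "'a aclass set \<Rightarrow> 'a form \<Rightarrow> bool" where
  "derives H C \<longleftrightarrow> (\<exists>D. marked_deduction D \<and> concl D = C \<and> open_assms D \<subseteq> H)"

lemma derives_assm: "(i, A) \<in> H \<Longrightarrow> derives H A"
  unfolding derives_def
  by (rule exI[of _ "Assm i A"]) (auto intro: marked_deduction.intros)

lemma formula_arbitrary:
  "P \<in> set (rule_premises r C) \<Longrightarrow> role P = Arbitrary \<Longrightarrow> formula P = C"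
  by (cases r) auto

text \<open>A premise with vacuous discharge already is a deduction of the conclusion.\<close>

lemma derives_rule:
  assumes r: "separates_marks r"
    and major: "\<And>P. P \<in> set (rule_premises r C) \<Longrightarrow> role P = Major \<Longrightarrow> (0, formula P) \<in> H"
    and other: "\<And>P. P \<in> set (rule_premises r C) \<Longrightarrow> role P \<noteq> Major \<Longrightarrow>
      derives (H \<union> discharged P) (formula P)"
  shows "derives H C"
proof -
  let ?Q = "\<lambda>P D. marked_deduction D \<and> concl D = formula P \<and> open_assms D \<subseteq> H \<union> discharged P \<and>
    (role P = Major \<longrightarrow> (\<exists>A. D = Assm 0 A))"
  have "\<exists>D. ?Q P D" if P: "P \<in> set (rule_premises r C)" for P
  proof (cases "role P = Major")
    case True
    then show ?thesis
      using major[OF P] by (intro exI[of _ "Assm 0 (formula P)"]) (auto intro: marked_deduction.intros)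
  next
    case False
    then show ?thesis using other[OF P] unfolding derives_def by auto
  qed
  then obtain f where f: "\<And>P. P \<in> set (rule_premises r C) \<Longrightarrow> ?Q P (f P)"
    by metis
  show ?thesis
  proof (cases "\<exists>P\<in>set (rule_premises r C). role P = Arbitrary \<and> open_assms (f P) \<inter> discharged P = {}")
    case True
    then obtain P where P: "P \<in> set (rule_premises r C)" "role P = Arbitrary"
        "open_assms (f P) \<inter> discharged P = {}"
      by blast
    then have "open_assms (f P) \<subseteq> H" using f[OF P(1)] by blast
    then show ?thesis
      using f[OF P(1)] formula_arbitrary[OF P(1,2)] unfolding derives_def by auto
  next
    case False
    let ?Ds = "map f (rule_premises r C)"
    have "marked_deduction (Infer r C ?Ds)"
      using f False r
      by (intro marked_deduction.intros) (auto simp: list_all2_map1 intro!: list.rel_refl_strong)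
    moreover have "open_assms (Infer r C ?Ds) \<subseteq> H"
      using f by (subst open_assms_Infer) (auto simp del: open_assms.simps, use nth_mem in blast)
    ultimately show ?thesis
      unfolding derives_def by (intro exI[of _ "Infer r C ?Ds"]) simp
  qed
qed

section \<open>Completeness of marked deductions\<close>

primrec subformulas :: "'a form \<Rightarrow> 'a form set" where
  "subformulas (Atom a) = {Atom a}"
| "subformulas (Neg A) = insert (Neg A) (subformulas A)"
| "subformulas (Imp A B) = insert (Imp A B) (subformulas A \<union> subformulas B)"
| "subformulas (Conj A B) = insert (Conj A B) (subformulas A \<union> subformulas B)"
| "subformulas (Disj A B) = insert (Disj A B) (subformulas A \<union> subformulas B)"

lemma finite_subformulas: "finite (subformulas A)"
  by (induction A) auto

lemma subformulas_refl: "A \<in> subformulas A"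
  by (cases A) auto

lemma subformulas_trans: "A \<in> subformulas B \<Longrightarrow> subformulas A \<subseteq> subformulas B"
  by (induction B) auto

text \<open>Compare sizes. This makes \<open>TR A B 0 1\<close> satisfy
  \<open>separates_marks\<close>.\<close>

lemma form_neq_Imp: "A \<noteq> Imp A B"
proof
  assume "A = Imp A B"
  then have "size A = size (Imp A B)" by (rule arg_cong)
  then show False by simp
qed

lemma form_neq_Neg: "A \<noteq> Neg A"
proof
  assume "A = Neg A"
  then have "size A = size (Neg A)" by (rule arg_cong)
  then show False by simp
qed

lemma derives_complete:
  fixes H :: "'a aclass set"
  assumes fin: "finite H" and marks: "fst ` H \<subseteq> {0}"
    and sem: "\<And>v. \<forall>x\<in>H. eval v (snd x) \<Longrightarrow> eval v C"
  shows "derives H C"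
proof (rule ccontr)
  assume nd: "\<not> derives H C"
  define S where "S = subformulas C \<union> (\<Union>x\<in>H. subformulas (snd x))"
  define U where "U = {0, 1 :: nat} \<times> S"
  have closed: "subformulas A \<subseteq> S" if "A \<in> S" for A
    using that subformulas_trans unfolding S_def by blast
  have HU: "H \<subseteq> U"
  proof
    fix x
    assume x: "x \<in> H"
    then have "fst x = 0" using marks by auto
    moreover have "snd x \<in> S" using x subformulas_refl unfolding S_def by blast
    ultimately show "x \<in> U" unfolding U_def by (cases x) auto
  qed
  have "finite U"
    using fin finite_subformulas unfolding U_def S_def by auto
  define F where "F = {M. H \<subseteq> M \<and> M \<subseteq> U \<and> \<not> derives M C}"
  have "finite F" "H \<in> F"
    using \<open>finite U\<close> nd HU unfolding F_def by (auto intro: finite_subset[of _ "Pow U"])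
  then obtain M where "M \<in> F" and maxF: "\<And>M'. M' \<in> F \<Longrightarrow> M \<subseteq> M' \<Longrightarrow> M = M'"
    using finite_has_maximal[of F] by blast
  then have M: "H \<subseteq> M" "M \<subseteq> U" "\<not> derives M C"
    unfolding F_def by auto
  have max: "derives M' C" if "M \<subseteq> M'" "M' \<subseteq> U" "M' \<noteq> M" for M'
    using that M(1) maxF[of M'] unfolding F_def by blast
  \<comment> \<open>Otherwise each arbitrary premise discharges something new, so \<open>C\<close>
    is derivable above it by maximality, and the rule derives \<open>C\<close> from
    \<open>M\<close>. As \<open>NegE\<close> has no arbitrary premise, its premises can never both
    be available.\<close>
  have saturated: "\<exists>P\<in>set (rule_premises r C). role P = Arbitrary \<and> discharged P \<subseteq> M"
    if "separates_marks r"
      and prem: "\<forall>P\<in>set (rule_premises r C). discharged P \<subseteq> U \<and>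
        (role P = Major \<longrightarrow> (0, formula P) \<in> M) \<and>
        (role P = Minor \<longrightarrow> formula P \<in> snd ` M)" for r
  proof (rule ccontr)
    assume neg: "\<not> ?thesis"
    have "derives M C"
    proof (rule derives_rule[OF that(1)])
      fix P
      assume P: "P \<in> set (rule_premises r C)"
      show "(0, formula P) \<in> M" if "role P = Major"
        using prem P that by blast
      show "derives (M \<union> discharged P) (formula P)" if "role P \<noteq> Major"
      proof (cases "role P")
        case Arbitrary
        then have "discharged P \<subseteq> U" "\<not> discharged P \<subseteq> M"
          using neg prem P by auto
        then have "derives (M \<union> discharged P) C"
          using M(2) by (intro max) auto
        then show ?thesis using formula_arbitrary[OF P Arbitrary] by simp
      next
        case Minor
        then obtain i where "(i, formula P) \<in> M" using prem P by fastforce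
        then show ?thesis by (intro derives_assm) blast
      qed (use that in simp)
    qed
    then show False using M(3) by blast
  qed
  have in_snd: "A \<in> snd ` M \<longleftrightarrow> (0, A) \<in> M \<or> (1, A) \<in> M" for A
    using M(2) unfolding U_def by force
  define v where "v a \<longleftrightarrow> (0, Atom a) \<in> M" for a
  \<comment> \<open>Elimination rules give the first half, as they discharge components under mark
    \<open>0\<close>; introduction rules give the second, placing the compound formula in
    \<open>M\<close> under mark \<open>1\<close>.\<close>
  have "((0, A) \<in> M \<longrightarrow> eval v A) \<and> (eval v A \<longrightarrow> A \<in> snd ` M)" if "A \<in> S" for A
    using that
  proof (induction A)
    case (Atom a)
    then show ?case by (simp add: v_def in_snd)
  next
    case (Neg A)
    have S: "A \<in> S" using closed[OF Neg.prems] subformulas_refl[of A] by auto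
    show ?case
      using Neg.IH[OF S] saturated[of "NegE A"] saturated[of "NegI A 0 1"] Neg.prems S
      by (auto simp: separates_marks_def U_def form_neq_Neg[symmetric] in_snd)
  next
    case (Imp A B)
    have S: "A \<in> S" "B \<in> S"
      using closed[OF Imp.prems] subformulas_refl[of A] subformulas_refl[of B] by auto
    \<comment> \<open>For a true implication, \<open>TR\<close> puts \<open>(0, A)\<close> or the
      implication into \<open>M\<close>. In the former case \<open>A\<close> is true, hence so is
      \<open>B\<close>, and \<open>ImpI\<close> applies.\<close>
    show ?case
      using Imp.IH S saturated[of "ImpE A B 0"] saturated[of "ImpI A B 1"]
        saturated[of "TR A B 0 1"] Imp.prems
      by (auto simp: separates_marks_def U_def form_neq_Imp[symmetric] in_snd)
  next
    case (Conj A B)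
    have S: "A \<in> S" "B \<in> S"
      using closed[OF Conj.prems] subformulas_refl[of A] subformulas_refl[of B] by auto
    show ?case
      using Conj.IH S saturated[of "ConjE A B 0 0"] saturated[of "ConjI A B 1"] Conj.prems
      by (auto simp: separates_marks_def U_def in_snd)
  next
    case (Disj A B)
    have S: "A \<in> S" "B \<in> S"
      using closed[OF Disj.prems] subformulas_refl[of A] subformulas_refl[of B] by auto
    show ?case
      using Disj.IH S saturated[of "DisjE A B 0 0"] saturated[of "DisjI1 A B 1"]
        saturated[of "DisjI2 A B 1"] Disj.prems
      by (auto simp: separates_marks_def U_def in_snd)
  qed
  note truth = this
  have "\<forall>x\<in>H. eval v (snd x)"
  proof
    fix x
    assume "x \<in> H"
    then have "x = (0, snd x)" "x \<in> M" "snd x \<in> S"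
      using marks M(1) HU unfolding U_def by (cases x; force)+
    then show "eval v (snd x)" using truth by metis
  qed
  then have "eval v C" using sem by blast
  then have "C \<in> snd ` M"
    using truth subformulas_refl unfolding S_def by blast
  then show False using M(3) derives_assm by fastforce
qed

theorem theorem1:
  fixes D :: "'a tree"
  assumes "deduction D"
  shows "\<exists>D'. deduction D' \<and> normal D' \<and> concl D' = concl D \<and>
           open_formulas D' \<subseteq> open_formulas D"
proof -
  \<comment> \<open>Renumbering every open assumption to \<open>0\<close> makes it eliminable and
    keeps its formula, which is all that \<open>open_formulas\<close> records.\<close>
  have "derives (Pair 0 ` open_formulas D) (concl D)"
    using deduction_sound[OF assms]
    by (intro derives_complete) (auto simp: open_formulas_def finite_open_assms)
  then obtain D' where D': "marked_deduction D'" "concl D' = concl D"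
      "open_assms D' \<subseteq> Pair 0 ` open_formulas D"
    unfolding derives_def by blast
  then have "open_formulas D' \<subseteq> open_formulas D"
    by (auto simp: open_formulas_def[of D'])
  then show ?thesis
    using D' marked_deduction_imp_deduction marked_deduction_normal by blast
qed

end
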